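(* Let $D_n$ be the dihedral group of order $2n$, let $a,a'\in C_n^\times$ and $b,b'\in C_n$. Put $d=\gcd(n,1-a,b)$ and $d'=\gcd(n,1-a',b')$. Then $Q(D_n,\varphi_{a,b})$ and $Q(D_n,\varphi_{a',b'})$ are isomorphic as quandles if and only if the following three conditions are satisfied: (1) $|\mathrm{Fix}(\varphi_{a,b},D_n)|=|\mathrm{Fix}(\varphi_{a',b'},D_n)|$; (2) $d=d'$; (3) $a\equiv a'\pmod{\frac{n}{d}}$.
   Context: $C_n=\{0,1,\ldots,n-1\}$ is the cyclic group with addition modulo $n$, and $C_n^\times=\{a\in C_n:\gcd(a,n)=1\}$. $D_n=\{\tau^\epsilon\sigma^i:\epsilon\in\{0,1\},\,0\le i\le n-1\}$ with relations $\tau^2=\sigma^n=e$, $\sigma\tau=\tau\sigma^{-1}$. For $a\in C_n^\times$, $b\in C_n$, $\varphi_{a,b}:D_n\to D_n$ is the group automorphism $\varphi_{a,b}(\tau^\epsilon\sigma^i)=\tau^\epsilon\sigma^{ai+\epsilon b}$. For a finite group $G$ and a group automorphism $\psi$, the generalized Alexander quandle $Q(G,\psi)$ is the set $G$ equipped with the maps $s_x:G\to G$, $s_x(y)=x\psi(x^{-1}y)$, for $x\in G$. A quandle isomorphism from $(Q,s)$ to $(Q',s')$ is a bijection $f:Q\to Q'$ with $f\circ s_x=s'_{f(x)}\circ f$ for all $x\in Q$. $\mathrm{Fix}(\psi,G)=\{x\in G:\psi(x)=x\}$. *)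

theory Defs
  imports "HOL-Algebra.Elementary_Groups" "HOL-Number_Theory.Cong"
begin

text \<open>A set with a binary operation, written as a family of maps \<open>s\<^sub>x\<close>, where
  \<open>qsym Q x y\<close> is \<open>s\<^sub>x(y)\<close>. The quandle axioms are not part of the type.\<close>

record 'a quandle = "'a partial_object" +
  qsym :: "'a \<Rightarrow> 'a \<Rightarrow> 'a"

definition quandle_iso :: "'a quandle \<Rightarrow> 'b quandle \<Rightarrow> ('a \<Rightarrow> 'b) set" where
  "quandle_iso Q Q' = {f. bij_betw f (carrier Q) (carrier Q') \<and>
     (\<forall>x\<in>carrier Q. \<forall>y\<in>carrier Q. f (qsym Q x y) = qsym Q' (f x) (f y))}"

definition quandle_isomorphic :: "'a quandle \<Rightarrow> 'b quandle \<Rightarrow> bool" where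
  "quandle_isomorphic Q Q' \<longleftrightarrow> quandle_iso Q Q' \<noteq> {}"

definition gen_alexander_quandle :: "'a monoid \<Rightarrow> ('a \<Rightarrow> 'a) \<Rightarrow> 'a quandle" where
  "gen_alexander_quandle G \<psi> =
     \<lparr>carrier = carrier G, qsym = (\<lambda>x y. x \<otimes>\<^bsub>G\<^esub> \<psi> (inv\<^bsub>G\<^esub> x \<otimes>\<^bsub>G\<^esub> y))\<rparr>"

definition fixed_points :: "('a \<Rightarrow> 'a) \<Rightarrow> 'a monoid \<Rightarrow> 'a set" where
  "fixed_points \<psi> G = {x \<in> carrier G. \<psi> x = x}"

text \<open>For \<open>n \<ge> 1\<close>, the pair \<open>(\<epsilon>, i)\<close> stands for \<open>\<tau>\<^sup>\<epsilon> \<sigma>\<^sup>i\<close>. The relation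
  \<open>\<sigma> \<tau> = \<tau> \<sigma>\<^sup>-\<^sup>1\<close> gives \<open>\<sigma>\<^sup>i \<tau> = \<tau> \<sigma>\<^sup>-\<^sup>i\<close>, whence the sign in the product
  \<open>(\<tau>\<^sup>\<epsilon> \<sigma>\<^sup>i) (\<tau>\<^sup>\<delta> \<sigma>\<^sup>j)\<close>. For \<open>n = 0\<close> this is the infinite dihedral group.\<close>

definition dihedral_group :: "nat \<Rightarrow> (int \<times> int) monoid" where
  "dihedral_group n =
     \<lparr>carrier = carrier (integer_mod_group 2) \<times> carrier (integer_mod_group n),
      monoid.mult = (\<lambda>(\<epsilon>, i) (\<delta>, j). ((\<epsilon> + \<delta>) mod 2, ((if \<delta> = 0 then i else - i) + j) mod int n)),
      one = (0, 0)\<rparr>"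

definition cyclic_units :: "nat \<Rightarrow> int set" where
  "cyclic_units n = {a \<in> carrier (integer_mod_group n). coprime a (int n)}"

definition dihedral_aut :: "nat \<Rightarrow> int \<Rightarrow> int \<Rightarrow> int \<times> int \<Rightarrow> int \<times> int" where
  "dihedral_aut n a b = (\<lambda>(\<epsilon>, i). (\<epsilon>, (a * i + \<epsilon> * b) mod int n))"

lemma carrier_dihedral_group:
  "n \<ge> 1 \<Longrightarrow> carrier (dihedral_group n) = {0, 1} \<times> {0..<int n}"
  by (auto simp: dihedral_group_def carrier_integer_mod_group)

lemma order_dihedral_group:
  "n \<ge> 1 \<Longrightarrow> order (dihedral_group n) = 2 * n"
  by (simp add: order_def carrier_dihedral_group card_cartesian_product)

lemma group_dihedral_group:
  assumes "n \<ge> 1"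
  shows "group (dihedral_group n)"
proof (rule groupI)
  fix x y z
  assume "x \<in> carrier (dihedral_group n)" "y \<in> carrier (dihedral_group n)"
    "z \<in> carrier (dihedral_group n)"
  then show "x \<otimes>\<^bsub>dihedral_group n\<^esub> y \<otimes>\<^bsub>dihedral_group n\<^esub> z =
      x \<otimes>\<^bsub>dihedral_group n\<^esub> (y \<otimes>\<^bsub>dihedral_group n\<^esub> z)"
    unfolding carrier_dihedral_group[OF assms]
    by (auto simp: dihedral_group_def mod_simps algebra_simps)
next
  fix x
  assume x: "x \<in> carrier (dihedral_group n)"
  obtain e i where [simp]: "x = (e, i)" by (cases x)
  have "(e, if e = 0 then (- i) mod int n else i) \<in> carrier (dihedral_group n)"
    using x assms unfolding carrier_dihedral_group[OF assms] by auto
  moreover have "(e, if e = 0 then (- i) mod int n else i) \<otimes>\<^bsub>dihedral_group n\<^esub> x =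
      \<one>\<^bsub>dihedral_group n\<^esub>"
    using x unfolding carrier_dihedral_group[OF assms]
    by (auto simp: dihedral_group_def mod_simps)
  ultimately show "\<exists>y\<in>carrier (dihedral_group n).
      y \<otimes>\<^bsub>dihedral_group n\<^esub> x = \<one>\<^bsub>dihedral_group n\<^esub>" by blast
qed (use assms in \<open>auto simp: dihedral_group_def carrier_integer_mod_group\<close>)

lemma dihedral_aut_iso:
  assumes "n \<ge> 1" "a \<in> cyclic_units n"
  shows "dihedral_aut n a b \<in> iso (dihedral_group n) (dihedral_group n)"
proof -
  let ?D = "dihedral_group n"
  have maps: "dihedral_aut n a b ` carrier ?D \<subseteq> carrier ?D"
    using assms(1) unfolding carrier_dihedral_group[OF assms(1)]
    by (auto simp: dihedral_aut_def)
  have "inj_on (dihedral_aut n a b) (carrier ?D)"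
  proof (rule inj_onI)
    fix x y
    assume xy: "x \<in> carrier ?D" "y \<in> carrier ?D"
      and eq: "dihedral_aut n a b x = dihedral_aut n a b y"
    obtain e i f j where [simp]: "x = (e, i)" "y = (f, j)" by (cases x, cases y)
    from eq have ef: "e = f" and "[a * i + e * b = a * j + e * b] (mod int n)"
      by (auto simp: dihedral_aut_def cong_def)
    then have "[a * i = a * j] (mod int n)"
      by (simp add: cong_add_rcancel)
    then have "[i = j] (mod int n)"
      using assms(2) by (simp add: cyclic_units_def cong_mult_lcancel)
    then have "i = j"
      using xy unfolding carrier_dihedral_group[OF assms(1)] by (auto simp: cong_def)
    with ef show "x = y" by simp
  qed
  moreover have "finite (carrier ?D)"
    by (simp add: carrier_dihedral_group[OF assms(1)])
  ultimately have bij: "bij_betw (dihedral_aut n a b) (carrier ?D) (carrier ?D)"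
    using maps by (simp add: bij_betw_def endo_inj_surj)
  have mod_eq: "(b + a * (x mod int n)) mod int n = (b + a * x) mod int n" for x
    by (metis mod_add_right_eq mod_mult_right_eq)
  have mod_eq2: "(b + (y + x mod int n)) mod int n = (b + (y + x)) mod int n" for x y
    by (metis add.assoc mod_add_right_eq)
  have hom: "dihedral_aut n a b \<in> hom ?D ?D"
  proof (rule homI)
    fix x y
    assume "x \<in> carrier ?D" "y \<in> carrier ?D"
    then show "dihedral_aut n a b (x \<otimes>\<^bsub>?D\<^esub> y) =
        dihedral_aut n a b x \<otimes>\<^bsub>?D\<^esub> dihedral_aut n a b y"
      unfolding carrier_dihedral_group[OF assms(1)]
      by (auto simp: mod_eq mod_eq2 dihedral_aut_def dihedral_group_def mod_simps algebra_simps)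
  qed (use maps in auto)
  from hom bij show ?thesis by (simp add: iso_def)
qed

end

theory Submission
  imports Defs "HOL-Computational_Algebra.Primes"
begin

text \<open>
  Write \<open>(e, i)\<close> for \<open>\<sigma>\<^sup>i\<close> if \<open>e = 0\<close> and for \<open>\<tau> \<sigma>\<^sup>-\<^sup>i\<close> if \<open>e = 1\<close>. In these coordinates the quandle
  operation of \<open>Q(D\<^sub>n, \<phi>)\<close>, \<open>\<phi> = \<phi>\<^bsub>a,b\<^esub>\<close>, is \<open>s\<^sub>x(y) = y + (p(x) - p(y))\<close>, where \<open>p(e, i) = (1 - a) i + e b\<close> is
  the weight of a point and \<open>+ k\<close> is the shift of the second coordinate by \<open>k\<close> modulo \<open>n\<close>. Weights
  satisfy \<open>p(y + k) = p(y) + (1 - a) k\<close>, and together with \<open>n\<close> they generate the ideal of the multiples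
  of \<open>d\<close>.

  The three conditions are necessary. An isomorphism preserves the number of fixed points of
  \<open>s\<^sub>x\<close>, which is the order of \<open>Fix(\<phi>)\<close> for every \<open>x\<close>. The maps \<open>s\<^sub>x s\<^sub>x\<^sub>'\<^sup>-\<^sup>1\<close> are the shifts by
  \<open>p(x) - p(x')\<close>, so they generate the cyclic group of shifts by multiples of \<open>d\<close>, of order
  \<open>n / d\<close>, on which conjugation by any \<open>s\<^sub>x\<close> acts as multiplication by \<open>a\<close>. An isomorphism \<open>f\<close>
  carries this group and this action to those of the other quandle: it satisfies
  \<open>f(y + d) = f(y) + d' c\<close> with one \<open>c\<close> for all \<open>y\<close> (\<open>quandle_iso_shift_gcd\<close>). Comparing orders gives
  \<open>d = d'\<close>, comparing the actions gives \<open>a \<equiv> a'\<close> modulo \<open>n / d\<close>.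

  They are sufficient. A bijection \<open>f\<close> is an isomorphism as soon as, for some \<open>u\<close>,
  \<open>f(y + k) = f(y) + u k\<close> for the multiples \<open>k\<close> of \<open>d\<close>, and \<open>p'(f(y)) = u p(y)\<close>
  (\<open>weight_quandle_isomorphicI\<close>). Such an \<open>f\<close> is determined by its values on the points
  \<open>(e, i)\<close> with \<open>0 \<le> i < d\<close>. Put \<open>g = gcd(n, 1 - a)\<close>. Then \<open>|Fix(\<phi>)|\<close> is \<open>2 g\<close> if \<open>g = d\<close> and \<open>g\<close>
  otherwise. With \<open>d = d'\<close>, equal numbers of fixed points therefore leave the case \<open>g = g'\<close>, where
  \<open>f\<close> can be chosen to preserve \<open>e\<close> (\<open>weight_quandle_isomorphic_equal_gcd\<close>), and the exceptional case
  \<open>g = d\<close>, \<open>g' = 2 d\<close> or its mirror image, where the coset of \<open>f(e, i)\<close> is given by the parity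
  of \<open>i\<close> (\<open>weight_quandle_isomorphic_double_gcd\<close>).
\<close>

section \<open>Quandle isomorphisms\<close>

lemma quandle_isomorphicI:
  assumes "bij_betw f (carrier Q) (carrier Q')"
    and "\<And>x y. x \<in> carrier Q \<Longrightarrow> y \<in> carrier Q \<Longrightarrow> f (qsym Q x y) = qsym Q' (f x) (f y)"
  shows "quandle_isomorphic Q Q'"
  using assms unfolding quandle_isomorphic_def quandle_iso_def by blast

lemma quandle_iso_inverse:
  assumes f: "f \<in> quandle_iso Q Q'"
    and closed: "\<And>x y. x \<in> carrier Q \<Longrightarrow> y \<in> carrier Q \<Longrightarrow> qsym Q x y \<in> carrier Q"
  shows "inv_into (carrier Q) f \<in> quandle_iso Q' Q"
proof -
  let ?g = "inv_into (carrier Q) f"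
  have bij: "bij_betw f (carrier Q) (carrier Q')"
    and hom: "\<And>x y. x \<in> carrier Q \<Longrightarrow> y \<in> carrier Q \<Longrightarrow> f (qsym Q x y) = qsym Q' (f x) (f y)"
    using f by (auto simp: quandle_iso_def)
  have "?g (qsym Q' x y) = qsym Q (?g x) (?g y)" if "x \<in> carrier Q'" "y \<in> carrier Q'" for x y
  proof -
    have g: "?g x \<in> carrier Q" "?g y \<in> carrier Q" "f (?g x) = x" "f (?g y) = y"
      using bij that by (auto simp: bij_betw_def inv_into_into f_inv_into_f)
    have "?g (qsym Q' x y) = ?g (f (qsym Q (?g x) (?g y)))"
      by (simp add: hom g)
    also have "\<dots> = qsym Q (?g x) (?g y)"
      using bij closed[OF g(1,2)] by (simp add: bij_betw_def)
    finally show ?thesis .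
  qed
  with bij show ?thesis
    by (simp add: quandle_iso_def bij_betw_inv_into)
qed

lemma quandle_isomorphic_sym:
  assumes "quandle_isomorphic Q Q'"
    and "\<And>x y. x \<in> carrier Q \<Longrightarrow> y \<in> carrier Q \<Longrightarrow> qsym Q x y \<in> carrier Q"
  shows "quandle_isomorphic Q' Q"
  using quandle_iso_inverse[of _ Q Q'] assms unfolding quandle_isomorphic_def by blast

lemma quandle_isomorphic_trans:
  assumes "quandle_isomorphic Q Q'" "quandle_isomorphic Q' Q''"
  shows "quandle_isomorphic Q Q''"
proof -
  obtain f g where f: "f \<in> quandle_iso Q Q'" and g: "g \<in> quandle_iso Q' Q''"
    using assms unfolding quandle_isomorphic_def by blast
  then have "bij_betw (g \<circ> f) (carrier Q) (carrier Q'')"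
    by (auto simp: quandle_iso_def intro: bij_betw_trans)
  then show ?thesis
    using f g by (intro quandle_isomorphicI[of "g \<circ> f"])
      (auto simp: quandle_iso_def dest: bij_betwE)
qed

lemma qsym_gen_alexander_quandle_closed:
  assumes "group G" "\<psi> \<in> hom G G" "x \<in> carrier G" "y \<in> carrier G"
  shows "qsym (gen_alexander_quandle G \<psi>) x y \<in> carrier G"
proof -
  interpret group G by fact
  show ?thesis
    using assms(2-4) by (auto simp: gen_alexander_quandle_def hom_def)
qed

text \<open>Left translation by \<open>x\<close> conjugates \<open>\<psi>\<close>, which is \<open>s\<^sub>e\<close> for the neutral element \<open>e\<close>, to \<open>s\<^sub>x\<close>.\<close>

lemma card_fixed_points_qsym:
  assumes "group G" "\<psi> \<in> hom G G" "x \<in> carrier G"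
  shows "card {y \<in> carrier G. qsym (gen_alexander_quandle G \<psi>) x y = y} = card (fixed_points \<psi> G)"
proof -
  interpret group G by fact
  have \<psi>: "\<psi> y \<in> carrier G" if "y \<in> carrier G" for y
    using assms(2) that by (auto simp: hom_def)
  have "bij_betw (\<lambda>y. x \<otimes>\<^bsub>G\<^esub> y) (fixed_points \<psi> G)
      {y \<in> carrier G. qsym (gen_alexander_quandle G \<psi>) x y = y}"
  proof (rule bij_betw_imageI)
    show "inj_on (\<lambda>y. x \<otimes>\<^bsub>G\<^esub> y) (fixed_points \<psi> G)"
      using assms(3) by (auto simp: fixed_points_def inj_on_def)
    show "(\<lambda>y. x \<otimes>\<^bsub>G\<^esub> y) ` fixed_points \<psi> G =
        {y \<in> carrier G. qsym (gen_alexander_quandle G \<psi>) x y = y}"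
    proof (intro equalityI subsetI)
      fix y assume "y \<in> (\<lambda>y. x \<otimes>\<^bsub>G\<^esub> y) ` fixed_points \<psi> G"
      then obtain z where "z \<in> carrier G" "\<psi> z = z" "y = x \<otimes>\<^bsub>G\<^esub> z"
        by (auto simp: fixed_points_def)
      then show "y \<in> {y \<in> carrier G. qsym (gen_alexander_quandle G \<psi>) x y = y}"
        using assms(3) by (simp add: gen_alexander_quandle_def m_assoc[symmetric])
    next
      fix y assume "y \<in> {y \<in> carrier G. qsym (gen_alexander_quandle G \<psi>) x y = y}"
      then have y: "y \<in> carrier G" and "x \<otimes>\<^bsub>G\<^esub> \<psi> (inv\<^bsub>G\<^esub> x \<otimes>\<^bsub>G\<^esub> y) = y"
        by (auto simp: gen_alexander_quandle_def)
      then have "\<psi> (inv\<^bsub>G\<^esub> x \<otimes>\<^bsub>G\<^esub> y) = inv\<^bsub>G\<^esub> x \<otimes>\<^bsub>G\<^esub> y"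
        using inv_solve_left[of "\<psi> (inv\<^bsub>G\<^esub> x \<otimes>\<^bsub>G\<^esub> y)" x y] assms(3) \<psi> by simp
      then have "inv\<^bsub>G\<^esub> x \<otimes>\<^bsub>G\<^esub> y \<in> fixed_points \<psi> G"
        using assms(3) y by (simp add: fixed_points_def)
      moreover have "y = x \<otimes>\<^bsub>G\<^esub> (inv\<^bsub>G\<^esub> x \<otimes>\<^bsub>G\<^esub> y)"
        using assms(3) y by (simp add: m_assoc[symmetric])
      ultimately show "y \<in> (\<lambda>y. x \<otimes>\<^bsub>G\<^esub> y) ` fixed_points \<psi> G"
        by blast
    qed
  qed
  then show ?thesis by (simp add: bij_betw_same_card)
qed

lemma quandle_isomorphic_imp_card_fixed_points_eq:
  assumes "group G" "\<psi> \<in> hom G G" "group H" "\<chi> \<in> hom H H"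
    and iso: "quandle_isomorphic (gen_alexander_quandle G \<psi>) (gen_alexander_quandle H \<chi>)"
  shows "card (fixed_points \<psi> G) = card (fixed_points \<chi> H)"
proof -
  let ?Q = "gen_alexander_quandle G \<psi>" and ?R = "gen_alexander_quandle H \<chi>"
  interpret G: group G by fact
  have carr: "carrier ?Q = carrier G" "carrier ?R = carrier H"
    by (simp_all add: gen_alexander_quandle_def)
  obtain f where bij: "bij_betw f (carrier G) (carrier H)"
    and hom: "\<And>x y. x \<in> carrier G \<Longrightarrow> y \<in> carrier G \<Longrightarrow> f (qsym ?Q x y) = qsym ?R (f x) (f y)"
    using iso by (auto simp: quandle_isomorphic_def quandle_iso_def carr)
  have closed: "qsym ?Q x y \<in> carrier G" if "x \<in> carrier G" "y \<in> carrier G" for x y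
    using that assms(1,2) by (intro qsym_gen_alexander_quandle_closed)
  let ?x = "\<one>\<^bsub>G\<^esub>"
  have "f ` {y \<in> carrier G. qsym ?Q ?x y = y} = {y \<in> carrier H. qsym ?R (f ?x) y = y}"
  proof (intro equalityI subsetI)
    fix z assume "z \<in> f ` {y \<in> carrier G. qsym ?Q ?x y = y}"
    then show "z \<in> {y \<in> carrier H. qsym ?R (f ?x) y = y}"
      using bij hom[OF G.one_closed, symmetric] by (auto simp: bij_betw_def)
  next
    fix z assume z: "z \<in> {y \<in> carrier H. qsym ?R (f ?x) y = y}"
    then obtain y where y: "y \<in> carrier G" "z = f y"
      using bij by (auto simp: bij_betw_def)
    then have "f (qsym ?Q ?x y) = f y"
      using z hom by simp
    then have "qsym ?Q ?x y = y"
      using bij y closed[OF G.one_closed y(1)] by (meson bij_betw_def inj_onD)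
    with y show "z \<in> f ` {y \<in> carrier G. qsym ?Q ?x y = y}" by auto
  qed
  moreover have "inj_on f {y \<in> carrier G. qsym ?Q ?x y = y}"
    using bij by (auto simp: bij_betw_def intro: inj_on_subset)
  ultimately have "card {y \<in> carrier G. qsym ?Q ?x y = y} = card {y \<in> carrier H. qsym ?R (f ?x) y = y}"
    using card_image by fastforce
  moreover have "f ?x \<in> carrier H"
    using bij by (auto simp: bij_betw_def)
  ultimately show ?thesis
    using card_fixed_points_qsym[OF assms(1,2) G.one_closed] card_fixed_points_qsym[OF assms(3,4)]
    by simp
qed

section \<open>Units and linear congruences modulo n\<close>

text \<open>This lifts units modulo \<open>m\<close> to units modulo \<open>N\<close>. Adding to \<open>w\<close> the multiple \<open>m t\<close>, where \<open>t\<close> is the product of the primes of \<open>N\<close> that do not divide \<open>w\<close>, makes every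
  prime of \<open>N\<close> divide exactly one of the two summands.\<close>

lemma exists_cong_coprime:
  fixes w m N :: int
  assumes "coprime w m" "N \<noteq> 0"
  obtains w' where "[w' = w] (mod m)" "coprime w' N"
proof -
  define t where "t = \<Prod>{p \<in> prime_factors N. \<not> p dvd w}"
  have "coprime (w + m * t) N"
  proof (rule ccontr)
    assume "\<not> coprime (w + m * t) N"
    then obtain p where p: "prime p" "p dvd w + m * t" "p dvd N"
    proof -
      have "gcd (w + m * t) N \<noteq> 0" "\<not> is_unit (gcd (w + m * t) N)"
        using assms(2) \<open>\<not> coprime (w + m * t) N\<close> by (simp, metis is_unit_gcd)
      then show thesis
        using prime_divisor_exists that by (meson gcd_dvd1 gcd_dvd2 dvd_trans)
    qed
    then have pN: "p \<in> prime_factors N"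
      using assms(2) by (simp add: prime_factors_dvd)
    show False
    proof (cases "p dvd w")
      case False
      then have "p dvd t"
        unfolding t_def using pN by (intro dvd_prodI) auto
      then show False
        using False p(2) by (simp add: dvd_add_left_iff)
    next
      case True
      then have "p dvd m * t"
        using p(2) by (simp add: dvd_add_right_iff)
      moreover have "\<not> p dvd m"
        using True assms(1) p(1) by (metis coprime_common_divisor not_prime_unit)
      ultimately have "p dvd t"
        using p(1) by (simp add: prime_dvd_mult_iff)
      then have "\<exists>q\<in>{p \<in> prime_factors N. \<not> p dvd w}. p dvd q"
        unfolding t_def using p(1) by (subst (asm) prime_dvd_prod_iff) auto
      then obtain q where q: "q \<in> prime_factors N" "\<not> q dvd w" "p dvd q"
        by blast
      moreover have "q = p"
        using primes_dvd_imp_eq[OF p(1) in_prime_factors_imp_prime[OF q(1)] q(3)] by simp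
      ultimately show False
        using True by simp
    qed
  qed
  then show thesis
    by (intro that[of "w + m * t"]) (simp_all add: cong_def)
qed

text \<open>Elements of \<open>\<int>/n\<close> that generate the same ideal are associates. The quotient of the cofactors
  is a unit modulo \<open>n / gcd x n\<close> only; it is lifted to one that is also prime to \<open>N\<close>, so that it can
  act on \<open>\<int>/N\<close>.\<close>

lemma associate_mod_unit:
  fixes x y n N :: int
  assumes gcd_eq: "gcd x n = gcd y n" and "n \<noteq> 0" "N \<noteq> 0"
  obtains w where "coprime w N" "[x * w = y] (mod n)"
proof -
  define g where "g = gcd x n"
  have g: "g \<noteq> 0" using assms(2) by (simp add: g_def)
  define x' y' m where "x' = x div g" and "y' = y div g" and "m = n div g"
  have "g dvd x" "g dvd y" "g dvd n"
    by (simp_all add: g_def) (simp add: gcd_eq)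
  then have xy: "x = g * x'" "y = g * y'" "n = g * m"
    by (simp_all add: x'_def y'_def m_def)
  have cop: "coprime x' m" "coprime y' m"
    unfolding x'_def y'_def m_def using g assms(2)
    by (auto simp: g_def intro!: div_gcd_coprime) (auto simp: gcd_eq intro!: div_gcd_coprime)
  obtain v where v: "[x' * v = 1] (mod m)"
    using cop(1) coprime_iff_invertible_int by blast
  have "coprime v m"
    using v by (metis coprime_iff_invertible_int mult.commute)
  then have "coprime (v * y') m"
    using cop(2) by simp
  then obtain w where w: "[w = v * y'] (mod m)" "coprime w N"
    using exists_cong_coprime assms(3) by blast
  have "[x' * w = x' * (v * y')] (mod m)"
    using w(1) by (rule cong_scalar_left)
  also have "[x' * (v * y') = y'] (mod m)"
    using cong_scalar_right[OF v, of y'] by (simp add: mult.assoc)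
  finally have "[x * w = y] (mod n)"
    unfolding xy by (simp add: cong_iff_dvd_diff mult.assoc flip: right_diff_distrib)
  with w(2) show thesis by (rule that)
qed

lemma linear_cong_solvable:
  fixes a n r :: int
  assumes "gcd a n dvd r"
  obtains s where "[a * s = r] (mod n)"
proof -
  obtain k where k: "r = gcd a n * k" using assms by blast
  obtain p q where pq: "p * a + q * n = gcd a n" using bezout_int by blast
  have "a * (p * k) - r = n * (- q * k)"
    unfolding k pq[symmetric] by (simp add: algebra_simps)
  then have "[a * (p * k) = r] (mod n)"
    by (metis cong_iff_dvd_diff dvd_triv_left)
  then show thesis by (rule that)
qed

lemma mult_cong_of_dvd:
  fixes d n x y k :: int
  assumes "[d * x = d * y] (mod n)" "d dvd k"
  shows "[x * k = y * k] (mod n)"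
proof -
  obtain l where "k = d * l" using assms(2) by blast
  then show ?thesis
    using cong_scalar_right[OF assms(1), of l] by (simp add: ac_simps)
qed

text \<open>If there is a solution, the solutions form one residue class modulo \<open>n / gcd n c\<close>.\<close>

lemma card_affine_cong_solutions:
  fixes c r :: int
  assumes "n \<ge> 1"
  shows "int (card {i \<in> {0..<int n}. int n dvd c * i + r}) =
    (if gcd (int n) c dvd r then gcd (int n) c else 0)"
proof (cases "gcd (int n) c dvd r")
  case False
  have "gcd (int n) c dvd r" if "int n dvd c * i + r" for i
  proof -
    have "gcd (int n) c dvd c * i + r" 
      using that by (meson dvd_trans gcd_dvd1)
    then show ?thesis
      by (simp add: dvd_add_right_iff)
  qed
  with False have "{i \<in> {0..<int n}. int n dvd c * i + r} = {}" by auto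
  with False show ?thesis by (simp only: card.empty) simp
next
  case True
  define g where "g = gcd (int n) c"
  define m c' r' where "m = int n div g" and "c' = c div g" and "r' = r div g"
  have g: "g > 0" using assms by (simp add: g_def)
  have eqs: "int n = g * m" "c = g * c'" "r = g * r'"
    unfolding m_def c'_def r'_def using True by (simp_all add: g_def)
  have m: "m > 0" using assms g eqs(1) by (metis of_nat_0_less_iff zero_less_mult_pos zero_less_one order_less_le_trans)
  have cop: "coprime c' m"
    unfolding c'_def m_def g_def using assms by (subst coprime_commute) (auto intro!: div_gcd_coprime)
  obtain v where v: "[c' * v = 1] (mod m)"
    using cop coprime_iff_invertible_int by blast
  define i0 where "i0 = (- v * r') mod m"
  have i0: "0 \<le> i0" "i0 < m" using m by (simp_all add: i0_def)
  have sol: "int n dvd c * i + r \<longleftrightarrow> i mod m = i0" for i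
  proof -
    have "int n dvd c * i + r \<longleftrightarrow> g * m dvd g * (c' * i + r')"
      by (simp add: eqs algebra_simps)
    also have "\<dots> \<longleftrightarrow> [c' * i = - r'] (mod m)"
      using g by (simp add: cong_iff_dvd_diff)
    also have "\<dots> \<longleftrightarrow> [c' * i = c' * (- v * r')] (mod m)"
    proof -
      have "[c' * (- v * r') = - r'] (mod m)"
        using cong_scalar_right[OF v, of "- r'"] by (simp add: algebra_simps)
      then show ?thesis by (meson cong_sym cong_trans)
    qed
    also have "\<dots> \<longleftrightarrow> [i = - v * r'] (mod m)"
      using cop by (rule cong_mult_lcancel)
    finally show ?thesis by (simp add: cong_def i0_def)
  qed
  have "bij_betw (\<lambda>k. i0 + m * k) {0..<g} {i \<in> {0..<int n}. int n dvd c * i + r}"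
  proof (rule bij_betw_byWitness[where f' = "\<lambda>i. i div m"])
    show "(\<lambda>k. i0 + m * k) ` {0..<g} \<subseteq> {i \<in> {0..<int n}. int n dvd c * i + r}"
    proof clarify
      fix k assume k: "k \<in> {0..<g}"
      have "m * (k + 1) \<le> m * g" using k m by (intro mult_left_mono) auto
      then have "i0 + m * k < int n"
        using i0 by (simp add: eqs(1) algebra_simps)
      then show "i0 + m * k \<in> {0..<int n} \<and> int n dvd c * (i0 + m * k) + r"
        using k i0 m sol[of "i0 + m * k"] by auto
    qed
    show "(\<lambda>i. i div m) ` {i \<in> {0..<int n}. int n dvd c * i + r} \<subseteq> {0..<g}"
    proof clarify
      fix i assume i: "i \<in> {0..<int n}"
      have "m * (i div m) \<le> i"
        using m pos_mod_sign[OF m, of i] by (simp add: minus_mod_eq_mult_div[symmetric])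
      then have "m * (i div m) < m * g"
        using i by (simp add: eqs(1) mult.commute)
      then show "i div m \<in> {0..<g}"
        using i m by (simp add: pos_imp_zdiv_nonneg_iff)
    qed
    show "\<forall>k\<in>{0..<g}. (i0 + m * k) div m = k"
      using i0 m by auto
    show "\<forall>i\<in>{i \<in> {0..<int n}. int n dvd c * i + r}. i0 + m * (i div m) = i"
      using sol by auto
  qed
  then have "card {i \<in> {0..<int n}. int n dvd c * i + r} = nat g"
    using bij_betw_same_card by fastforce
  with True g show ?thesis by (simp add: g_def)
qed

section \<open>The linear model of a dihedral quandle\<close>

definition shift :: "nat \<Rightarrow> int \<Rightarrow> int \<times> int \<Rightarrow> int \<times> int" where
  "shift n k y = (fst y, (snd y + k) mod int n)"

definition weight :: "int \<Rightarrow> int \<Rightarrow> int \<times> int \<Rightarrow> int" where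
  "weight a b y = (1 - a) * snd y + fst y * b"

text \<open>The pair \<open>(e, i)\<close> stands for \<open>\<tau>\<^sup>e \<sigma>\<^sup>i\<close> if \<open>e = 0\<close>, but for \<open>\<tau>\<^sup>e \<sigma>\<^sup>-\<^sup>i\<close> if \<open>e = 1\<close>: this sign makes one
  formula serve for all four combinations of cosets of the rotation subgroup.\<close>

definition weight_quandle :: "nat \<Rightarrow> int \<Rightarrow> int \<Rightarrow> (int \<times> int) quandle" where
  "weight_quandle n a b =
     \<lparr>carrier = {0, 1} \<times> {0..<int n}, qsym = (\<lambda>x y. shift n (weight a b x - weight a b y) y)\<rparr>"

lemma carrier_weight_quandle [simp]: "carrier (weight_quandle n a b) = {0, 1} \<times> {0..<int n}"
  and qsym_weight_quandle [simp]:
    "qsym (weight_quandle n a b) x y = shift n (weight a b x - weight a b y) y"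
  by (simp_all add: weight_quandle_def)

lemma shift_shift: "shift n k (shift n l y) = shift n (l + k) y"
  by (simp add: shift_def mod_simps algebra_simps)

lemma shift_in_carrier:
  "n \<ge> 1 \<Longrightarrow> y \<in> {0, 1} \<times> {0..<int n} \<Longrightarrow> shift n k y \<in> {0, 1} \<times> {0..<int n}"
  by (auto simp: shift_def)

lemma shift_eq_shift_iff: "shift n k y = shift n l y \<longleftrightarrow> [k = l] (mod int n)"
  unfolding shift_def by (simp flip: cong_def add: cong_add_lcancel)

lemma shift_zero: "y \<in> {0, 1} \<times> {0..<int n} \<Longrightarrow> shift n 0 y = y"
  by (auto simp: shift_def)

lemma weight_shift: "[weight a b (shift n k y) = weight a b y + (1 - a) * k] (mod int n)"
proof -
  have "[(1 - a) * ((snd y + k) mod int n) + fst y * b = (1 - a) * (snd y + k) + fst y * b] (mod int n)"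
    by (intro cong_add cong_mult) (simp_all add: cong_def)
  then show ?thesis by (simp add: weight_def shift_def algebra_simps)
qed

lemma weight_pair_mod: "[weight a b (e, z mod int n) = (1 - a) * z + e * b] (mod int n)"
  using weight_shift[of a b n z "(e, 0)"] by (simp add: shift_def weight_def add.commute)

lemma dvd_weight: "d dvd 1 - a \<Longrightarrow> d dvd b \<Longrightarrow> d dvd weight a b y"
  by (simp add: weight_def)

lemma dihedral_quandle_isomorphic_weight_quandle:
  assumes n: "n \<ge> 1"
  shows "quandle_isomorphic (gen_alexander_quandle (dihedral_group n) (dihedral_aut n a b))
    (weight_quandle n a b)"
proof (rule quandle_isomorphicI)
  let ?D = "dihedral_group n"
  let ?f = "\<lambda>(e, i). (e :: int, if e = 0 then i else (- i) mod int n)"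
  interpret group ?D using n by (rule group_dihedral_group)
  have carr: "carrier (gen_alexander_quandle ?D (dihedral_aut n a b)) = {0, 1} \<times> {0..<int n}"
    by (simp add: gen_alexander_quandle_def carrier_dihedral_group[OF n])
  show "bij_betw ?f (carrier (gen_alexander_quandle ?D (dihedral_aut n a b)))
      (carrier (weight_quandle n a b))"
    unfolding carr carrier_weight_quandle
    by (rule bij_betw_byWitness[where f' = ?f]) (use n in \<open>auto simp: mod_simps\<close>)
  fix x y
  assume "x \<in> carrier (gen_alexander_quandle ?D (dihedral_aut n a b))"
    and "y \<in> carrier (gen_alexander_quandle ?D (dihedral_aut n a b))"
  then have xy: "x \<in> {0, 1} \<times> {0..<int n}" "y \<in> {0, 1} \<times> {0..<int n}"
    by (simp_all add: carr)
  obtain e i where x: "x = (e, i)" by (cases x)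
  obtain f j where y: "y = (f, j)" by (cases y)
  define q where "q z = - (z div int n)" for z
  have q: "z mod int n = z + int n * q z" for z
    by (simp add: q_def minus_mult_div_eq_mod[symmetric])
  have inv: "inv\<^bsub>?D\<^esub> x = (e, if e = 0 then (- i) mod int n else i)"
    using xy(1) n by (intro inv_equality)
      (auto simp: x dihedral_group_def mod_simps carrier_integer_mod_group)
  show "?f (qsym (gen_alexander_quandle ?D (dihedral_aut n a b)) x y) =
      qsym (weight_quandle n a b) (?f x) (?f y)"
    using xy n
    apply (auto simp: inv gen_alexander_quandle_def)
    apply (auto simp: x y dihedral_group_def dihedral_aut_def shift_def weight_def)
    \<comment> \<open>With each remainder written as \<open>z + n * q z\<close>, the two sides visibly differ by a multiple of \<open>n\<close>.\<close>
    apply (simp_all only: mod_eq_dvd_iff)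
    apply (simp_all only: q)
    apply (simp_all add: algebra_simps)
    done
qed

text \<open>The rotations \<open>\<sigma>\<^sup>i\<close> with \<open>(1 - a) i = 0\<close> contribute \<open>g\<close> fixed points; the reflections
  \<open>\<tau> \<sigma>\<^sup>i\<close> with \<open>(1 - a) i = b\<close> contribute \<open>g\<close> or none.\<close>

lemma card_fixed_points_dihedral_aut:
  assumes n: "n \<ge> 1" and g: "g = gcd (int n) (1 - a)"
  shows "int (card (fixed_points (dihedral_aut n a b) (dihedral_group n))) =
    (if g dvd b then 2 * g else g)"
proof -
  let ?S = "\<lambda>r. {i \<in> {0..<int n}. int n dvd (1 - a) * i + r}"
  have fix_iff: "(a * i + r) mod int n = i \<longleftrightarrow> int n dvd (1 - a) * i + (- r)" if "0 \<le> i" "i < int n" for i r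
  proof -
    have "(a * i + r) mod int n = i \<longleftrightarrow> [a * i + r = i] (mod int n)"
      using that by (simp add: cong_def)
    also have "\<dots> \<longleftrightarrow> int n dvd - ((1 - a) * i + (- r))"
      by (simp add: cong_iff_dvd_diff algebra_simps)
    finally show ?thesis by (simp only: dvd_minus_iff)
  qed
  have "fixed_points (dihedral_aut n a b) (dihedral_group n) = {0} \<times> ?S 0 \<union> {1} \<times> ?S (- b)"
    using fix_iff[of _ 0] fix_iff[of _ b]
    by (auto simp: fixed_points_def carrier_dihedral_group[OF n] dihedral_aut_def)
  moreover have "card ({0 :: int} \<times> ?S 0 \<union> {1} \<times> ?S (- b)) = card (?S 0) + card (?S (- b))"
  proof -
    have fin: "finite (?S r)" for r
      by (rule finite_subset[of _ "{0..<int n}"]) auto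
    have "card ({0 :: int} \<times> A \<union> {1} \<times> B) = card A + card B"
      if "finite A" "finite B" for A B :: "int set"
      by (subst card_Un_disjoint) (use that in \<open>auto simp: card_cartesian_product_singleton\<close>)
    from this[OF fin fin] show ?thesis .
  qed
  ultimately have "int (card (fixed_points (dihedral_aut n a b) (dihedral_group n))) =
      int (card (?S 0)) + int (card (?S (- b)))"
    by (simp only: of_nat_add)
  then show ?thesis
    unfolding card_affine_cong_solutions[OF n] by (simp add: g)
qed

section \<open>The effect of an isomorphism on shifts\<close>

lemma shift_transport_multiple:
  assumes n: "n \<ge> 1"
    and f: "\<And>y. y \<in> {0, 1} \<times> {0..<int n} \<Longrightarrow> f (shift n k y) = shift n l (f y)"
    and range: "\<And>y. y \<in> {0, 1} \<times> {0..<int n} \<Longrightarrow> f y \<in> {0, 1} \<times> {0..<int n}"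
    and y: "y \<in> {0, 1} \<times> {0..<int n}"
  shows "f (shift n (m * k) y) = shift n (m * l) (f y)"
proof -
  have nat: "f (shift n (int j * k) y) = shift n (int j * l) (f y)" for j
  proof (induction j)
    case 0
    show ?case using y range[OF y] by (simp add: shift_zero)
  next
    case (Suc j)
    have "f (shift n (int (Suc j) * k) y) = f (shift n k (shift n (int j * k) y))"
      by (simp add: shift_shift algebra_simps)
    also have "\<dots> = shift n l (f (shift n (int j * k) y))"
      by (intro f shift_in_carrier n y)
    finally show ?case
      by (simp only: Suc shift_shift) (simp add: algebra_simps)
  qed
  have red: "shift n (m * t) z = shift n (int (nat (m mod int n)) * t) z" for t z
    using n by (simp add: shift_eq_shift_iff cong_def mod_simps)
  show ?thesis
    using nat[of "nat (m mod int n)"] by (simp only: red[of k] red[of l])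
qed

text \<open>The shifts that \<open>f\<close> carries to a shift by a multiple of \<open>d'\<close> form a group. It contains the shift
  by \<open>p(x) - p(x')\<close>, which is \<open>s\<^sub>x s\<^sub>x\<^sub>'\<^sup>-\<^sup>1\<close> and becomes the shift by \<open>p'(f x) - p'(f x')\<close>. Suitable
  \<open>x\<close> and \<open>x'\<close> yield the shifts by \<open>1 - a\<close> and by \<open>b\<close>, hence the one by the greatest common
  divisor.\<close>

lemma quandle_iso_shift_gcd:
  assumes n: "n \<ge> 1" and a: "coprime a (int n)"
    and f: "f \<in> quandle_iso (weight_quandle n a b) (weight_quandle n a' b')"
    and d': "d' dvd 1 - a'" "d' dvd b'"
  obtains c where "\<And>y. y \<in> {0, 1} \<times> {0..<int n} \<Longrightarrow>
    f (shift n (gcd (int n) (gcd (1 - a) b)) y) = shift n (d' * c) (f y)"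
proof -
  define X where "X = {0 :: int, 1} \<times> {0..<int n}"
  have range: "f y \<in> X" if "y \<in> X" for y
    using f that unfolding X_def by (auto simp: quandle_iso_def dest: bij_betwE)
  have hom: "f (shift n (weight a b x - weight a b y) y) =
      shift n (weight a' b' (f x) - weight a' b' (f y)) (f y)" if "x \<in> X" "y \<in> X" for x y
    using f that unfolding X_def by (auto simp: quandle_iso_def)
  have sh: "shift n k y \<in> X" if "y \<in> X" for k y
    using that n unfolding X_def by (intro shift_in_carrier)
  \<comment> \<open>The group of those \<open>k\<close> for which \<open>f\<close> carries the shift by \<open>k\<close> to a shift by a multiple of \<open>d'\<close>.\<close>
  define K where "K k \<longleftrightarrow> (\<exists>c. \<forall>y\<in>X. f (shift n k y) = shift n (d' * c) (f y))" for k
  have K_cong: "K l" if "K k" "[k = l] (mod int n)" for k l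
  proof -
    have "shift n l y = shift n k y" for y
      using that(2) by (simp add: shift_eq_shift_iff cong_sym)
    then show ?thesis using that(1) by (simp add: K_def)
  qed
  have K_add: "K (k + l)" if "K k" "K l" for k l
  proof -
    obtain c e where c: "\<And>y. y \<in> X \<Longrightarrow> f (shift n k y) = shift n (d' * c) (f y)"
      and e: "\<And>y. y \<in> X \<Longrightarrow> f (shift n l y) = shift n (d' * e) (f y)"
      using \<open>K k\<close> \<open>K l\<close> unfolding K_def by blast
    have "f (shift n (k + l) y) = shift n (d' * (c + e)) (f y)" if "y \<in> X" for y
      using c[OF that] e[OF sh[OF that, of k]] by (simp add: shift_shift algebra_simps)
    then show ?thesis unfolding K_def by blast
  qed
  have K_mult: "K (m * k)" if "K k" for m k
  proof -
    obtain c where c: "\<And>y. y \<in> X \<Longrightarrow> f (shift n k y) = shift n (d' * c) (f y)"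
      using \<open>K k\<close> unfolding K_def by blast
    have "f (shift n (m * k) y) = shift n (d' * (m * c)) (f y)" if "y \<in> X" for y
      using shift_transport_multiple[OF n, of f k "d' * c" y m] c range that
      by (simp add: X_def ac_simps)
    then show ?thesis unfolding K_def by blast
  qed
  have K_diff: "K (weight a b x - weight a b x')" if x: "x \<in> X" "x' \<in> X" for x x'
  proof -
    have "d' dvd weight a' b' (f x) - weight a' b' (f x')"
      using dvd_weight[OF d'] by (intro dvd_diff)
    then obtain c where c: "weight a' b' (f x) - weight a' b' (f x') = d' * c" by blast
    obtain v where v: "[a * v = 1] (mod int n)"
      using a coprime_iff_invertible_int by blast
    have "f (shift n (weight a b x - weight a b x') y) = shift n (d' * c) (f y)" if y: "y \<in> X" for y
    proof -
      \<comment> \<open>\<open>z\<close> is the preimage of \<open>y\<close> under \<open>s\<^sub>x\<^sub>'\<close>, so that \<open>s\<^sub>x z\<close> is the shift of \<open>y\<close>.\<close>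
      define z where "z = shift n (v * (weight a b y - weight a b x')) y"
      have z: "z \<in> X" unfolding z_def by (rule sh[OF y])
      \<comment> \<open>Shifting \<open>y\<close> by \<open>k\<close> changes \<open>snd y - weight a b y\<close> by \<open>a * k\<close>; hence the inverse \<open>v\<close> of \<open>a\<close> in \<open>z\<close>.\<close>
      have qz: "shift n (t - weight a b z) z = shift n (t - weight a b x') y" for t
      proof -
        let ?k = "v * (weight a b y - weight a b x')"
        have "[?k + (t - weight a b z) = ?k + (t - (weight a b y + (1 - a) * ?k))] (mod int n)"
          unfolding z_def by (intro cong_add cong_diff cong_refl weight_shift)
        also have "?k + (t - (weight a b y + (1 - a) * ?k)) =
            a * v * (weight a b y - weight a b x') + (t - weight a b y)"
          by (simp add: algebra_simps)
        also have "[\<dots> = 1 * (weight a b y - weight a b x') + (t - weight a b y)] (mod int n)"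
          by (intro cong_add cong_mult v cong_refl)
        finally show ?thesis
          by (subst z_def) (simp add: shift_shift shift_eq_shift_iff)
      qed
      have "y = shift n (weight a b x' - weight a b z) z"
        using y by (simp add: qz shift_zero X_def)
      then have fy: "f y = shift n (weight a' b' (f x') - weight a' b' (f z)) (f z)"
        using hom[OF x(2) z] by simp
      have "f (shift n (weight a b x - weight a b x') y) =
          shift n (weight a' b' (f x) - weight a' b' (f z)) (f z)"
        using hom[OF x(1) z] by (simp add: qz)
      also have "\<dots> = shift n (d' * c) (f y)"
        by (simp add: fy shift_shift flip: c)
      finally show ?thesis .
    qed
    then show ?thesis unfolding K_def by blast
  qed
  have zero: "(0, 0) \<in> X" using n by (simp add: X_def)
  \<comment> \<open>The point \<open>(0, 1 mod int n)\<close> is \<open>(0, 0)\<close> for \<open>n = 1\<close>.\<close>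
  have "K ((1 - a) * (1 mod int n))"
    using K_diff[of "(0, 1 mod int n)" "(0, 0)"] n zero by (simp add: X_def weight_def)
  then have Ka: "K (1 - a)"
    by (rule K_cong) (simp add: cong_def mod_simps)
  have Kb: "K b"
    using K_diff[of "(1, 0)" "(0, 0)"] n zero by (simp add: X_def weight_def)
  have "K 0"
    using K_diff[OF zero zero] by simp
  then have Kn: "K (int n)"
    by (rule K_cong) (simp add: cong_def)
  obtain p q where pq: "p * (1 - a) + q * b = gcd (1 - a) b"
    using bezout_int by blast
  obtain r s where rs: "r * int n + s * gcd (1 - a) b = gcd (int n) (gcd (1 - a) b)"
    using bezout_int by blast
  have "K (gcd (1 - a) b)"
    using K_add[OF K_mult[OF Ka, of p] K_mult[OF Kb, of q]] pq by simp
  then have "K (gcd (int n) (gcd (1 - a) b))"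
    using K_add[OF K_mult[OF Kn, of r] K_mult, of "gcd (1 - a) b" s] rs by simp
  then show thesis
    using that unfolding K_def X_def by blast
qed

text \<open>Let \<open>n = m d'\<close> and let \<open>d\<close> be the greatest common divisor in the conclusion. Then \<open>f\<close> carries the
  shift by \<open>m d\<close> to a shift by a multiple of \<open>m d' = n\<close>, which is the identity, so \<open>n\<close> divides \<open>m d\<close>.\<close>

lemma weight_quandle_iso_gcd_dvd:
  assumes n: "n \<ge> 1" and a: "coprime a (int n)"
    and f: "f \<in> quandle_iso (weight_quandle n a b) (weight_quandle n a' b')"
    and d': "d' dvd int n" "d' dvd 1 - a'" "d' dvd b'"
  shows "d' dvd gcd (int n) (gcd (1 - a) b)"
proof -
  let ?X = "{0 :: int, 1} \<times> {0..<int n}" and ?d = "gcd (int n) (gcd (1 - a) b)"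
  have bij: "bij_betw f ?X ?X"
    using f by (simp add: quandle_iso_def)
  then have range: "f y \<in> ?X" if "y \<in> ?X" for y
    using that by (rule bij_betwE[rule_format])
  obtain c where c: "\<And>y. y \<in> ?X \<Longrightarrow> f (shift n ?d y) = shift n (d' * c) (f y)"
    using quandle_iso_shift_gcd[OF n a f d'(2,3)] by blast
  obtain m where m: "int n = d' * m" using d'(1) by blast
  have zero: "(0, 0) \<in> ?X" using n by simp
  have "f (shift n (m * ?d) (0, 0)) = shift n (m * (d' * c)) (f (0, 0))"
    using shift_transport_multiple[of n f ?d "d' * c" "(0, 0)" m, OF n c range zero] by simp
  also have "\<dots> = shift n 0 (f (0, 0))"
    by (simp add: shift_eq_shift_iff cong_def m mult.assoc[symmetric] mult.commute[of m d'])
  also have "\<dots> = f (0, 0)"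
    by (rule shift_zero[OF range[OF zero]])
  finally have "shift n (m * ?d) (0, 0) = (0, 0)"
    using bij zero shift_in_carrier[OF n zero] by (meson bij_betw_def inj_onD)
  then have "int n dvd m * ?d"
    by (simp add: shift_def mod_eq_0_iff_dvd)
  then have "m * d' dvd m * ?d" by (simp only: m mult.commute)
  moreover have "m \<noteq> 0" using m n by auto
  ultimately show ?thesis by simp
qed

text \<open>Since \<open>s\<^sub>x(y + k) = s\<^sub>x(y) + a k\<close>, applying \<open>f\<close> to \<open>s\<^sub>y(y + d)\<close> yields \<open>a d c = a' d c\<close>. The inverse
  of \<open>f\<close> provides \<open>c'\<close> with \<open>c' d c = d\<close>, and \<open>c\<close> can be cancelled.\<close>

lemma weight_quandle_iso_cong:
  assumes n: "n \<ge> 1" and a: "coprime a (int n)" "coprime a' (int n)"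
    and f: "f \<in> quandle_iso (weight_quandle n a b) (weight_quandle n a' b')"
    and d: "d = gcd (int n) (gcd (1 - a) b)" "d = gcd (int n) (gcd (1 - a') b')"
  shows "[d * a = d * a'] (mod int n)"
proof -
  define X where "X = {0 :: int, 1} \<times> {0..<int n}"
  have bij: "bij_betw f X X"
    using f by (simp add: quandle_iso_def X_def)
  have range: "f y \<in> X" if "y \<in> X" for y
    using bij that by (rule bij_betwE[rule_format])
  have hom: "f (shift n (weight a b x - weight a b y) y) =
      shift n (weight a' b' (f x) - weight a' b' (f y)) (f y)" if "x \<in> X" "y \<in> X" for x y
    using f that unfolding X_def by (auto simp: quandle_iso_def)
  have sh: "shift n k y \<in> X" if "y \<in> X" for k y
    using that n unfolding X_def by (intro shift_in_carrier)
  have d_dvd: "d dvd 1 - a" "d dvd b"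
    unfolding d(1) by (meson dvd_trans gcd_dvd1 gcd_dvd2)+
  have d_dvd': "d dvd 1 - a'" "d dvd b'"
    unfolding d(2) by (meson dvd_trans gcd_dvd1 gcd_dvd2)+
  obtain c where c: "\<And>y. y \<in> X \<Longrightarrow> f (shift n d y) = shift n (d * c) (f y)"
    using quandle_iso_shift_gcd[OF n a(1) f d_dvd'] unfolding d(1) X_def by blast
  have cm: "f (shift n (m * d) y) = shift n (m * (d * c)) (f y)" if "y \<in> X" for m y
    using shift_transport_multiple[OF n, of f d "d * c" y m] c range that by (simp add: X_def)
  define g where "g = inv_into X f"
  have g: "g \<in> quandle_iso (weight_quandle n a' b') (weight_quandle n a b)"
    using quandle_iso_inverse[OF f] shift_in_carrier[OF n] by (simp add: g_def X_def)
  obtain c' where c': "\<And>y. y \<in> X \<Longrightarrow> g (shift n d y) = shift n (d * c') (g y)"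
    using quandle_iso_shift_gcd[OF n a(2) g d_dvd] unfolding d(2) X_def by blast
  have gf: "g (f y) = y" if "y \<in> X" for y
    using bij that by (simp add: g_def bij_betw_def)
  have fg: "f (g y) = y" if "y \<in> X" for y
    using bij that by (simp add: g_def bij_betw_def f_inv_into_f)
  define y where "y = (0 :: int, 0 :: int)"
  have y: "y \<in> X" using n by (simp add: X_def y_def)
  have "shift n d (f y) = f (g (shift n d (f y)))"
    by (simp add: fg sh range y)
  also have "\<dots> = f (shift n (c' * d) y)"
    by (simp add: c' range y gf mult.commute)
  also have "\<dots> = shift n (c' * (d * c)) (f y)"
    by (rule cm[OF y])
  finally have unit: "[d = c' * (d * c)] (mod int n)"
    by (simp add: shift_eq_shift_iff)
  \<comment> \<open>\<open>f (s\<^sub>y (y + d))\<close>, computed in the first and then in the second quandle.\<close>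
  have "shift n (a * (d * c)) (f y) = f (shift n (weight a b y - weight a b (shift n d y)) (shift n d y))"
  proof -
    have "[d + (weight a b y - weight a b (shift n d y)) =
        d + (weight a b y - (weight a b y + (1 - a) * d))] (mod int n)"
      by (intro cong_add cong_diff cong_refl weight_shift)
    also have "d + (weight a b y - (weight a b y + (1 - a) * d)) = a * d"
      by (simp add: algebra_simps)
    finally show ?thesis
      by (simp add: shift_shift flip: cm[OF y] shift_eq_shift_iff[of _ _ y])
  qed
  also have "\<dots> = shift n (weight a' b' (f y) - weight a' b' (shift n (d * c) (f y))) (shift n (d * c) (f y))"
    using hom[OF y sh[OF y]] by (simp add: c y)
  also have "\<dots> = shift n (a' * (d * c)) (f y)"
  proof -
    have "[d * c + (weight a' b' (f y) - weight a' b' (shift n (d * c) (f y))) =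
        d * c + (weight a' b' (f y) - (weight a' b' (f y) + (1 - a') * (d * c)))] (mod int n)"
      by (intro cong_add cong_diff cong_refl weight_shift)
    also have "d * c + (weight a' b' (f y) - (weight a' b' (f y) + (1 - a') * (d * c))) = a' * (d * c)"
      by (simp add: algebra_simps)
    finally show ?thesis
      by (simp add: shift_shift shift_eq_shift_iff)
  qed
  finally have eq: "[a * (d * c) = a' * (d * c)] (mod int n)"
    by (simp add: shift_eq_shift_iff)
  have "[a * d = a * (c' * (d * c))] (mod int n)"
    by (intro cong_mult cong_refl unit)
  also have "a * (c' * (d * c)) = c' * (a * (d * c))" by simp
  also have "[\<dots> = c' * (a' * (d * c))] (mod int n)"
    by (intro cong_mult cong_refl eq)
  also have "c' * (a' * (d * c)) = a' * (c' * (d * c))" by simp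
  also have "[\<dots> = a' * d] (mod int n)"
    by (intro cong_mult cong_refl cong_sym[OF unit])
  finally show ?thesis by (simp add: mult.commute)
qed

section \<open>Construction of isomorphisms\<close>

lemma weight_quandle_isomorphicI:
  assumes "n \<ge> 1" "d dvd 1 - a" "d dvd b"
    and range: "\<And>y. y \<in> {0, 1} \<times> {0..<int n} \<Longrightarrow> f y \<in> {0, 1} \<times> {0..<int n}"
    and inj: "inj_on f ({0, 1} \<times> {0..<int n})"
    and shift: "\<And>y k. y \<in> {0, 1} \<times> {0..<int n} \<Longrightarrow> d dvd k \<Longrightarrow>
      f (shift n k y) = shift n (u * k) (f y)"
    and weight: "\<And>y. y \<in> {0, 1} \<times> {0..<int n} \<Longrightarrow>
      [weight a' b' (f y) = u * weight a b y] (mod int n)"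
  shows "quandle_isomorphic (weight_quandle n a b) (weight_quandle n a' b')"
proof (rule quandle_isomorphicI)
  show "bij_betw f (carrier (weight_quandle n a b)) (carrier (weight_quandle n a' b'))"
    unfolding carrier_weight_quandle bij_betw_def
    using inj range by (intro conjI endo_inj_surj image_subsetI) (auto simp del: mem_Sigma_iff)
next
  fix x y
  assume "x \<in> carrier (weight_quandle n a b)" "y \<in> carrier (weight_quandle n a b)"
  then have xy: "x \<in> {0, 1} \<times> {0..<int n}" "y \<in> {0, 1} \<times> {0..<int n}" by simp_all
  have "f (shift n (weight a b x - weight a b y) y) =
      shift n (u * (weight a b x - weight a b y)) (f y)"
    using dvd_weight[OF assms(2,3)] by (intro shift xy dvd_diff)
  also have "\<dots> = shift n (weight a' b' (f x) - weight a' b' (f y)) (f y)"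
    using weight[OF xy(1)] weight[OF xy(2)]
    by (simp add: shift_eq_shift_iff right_diff_distrib cong_diff cong_sym)
  finally show "f (qsym (weight_quandle n a b) x y) = qsym (weight_quandle n a' b') (f x) (f y)"
    by simp
qed

text \<open>The isomorphism is \<open>(e, i + k) \<mapsto> (e, w i + e s + u k)\<close> for \<open>0 \<le> i < d\<close> and \<open>d\<close> dividing \<open>k\<close>. The condition
  that it multiplies weights by \<open>u\<close> reads \<open>(1 - a') w = u (1 - a)\<close> and \<open>(1 - a') s = u b - b'\<close> modulo
  \<open>n\<close>. The second congruence is solvable in \<open>s\<close> if \<open>u b = b'\<close> modulo \<open>gcd n (1 - a')\<close>, and units \<open>u\<close>
  and \<open>w\<close> exist because the ideals in question agree. The map is injective because \<open>w\<close> is a unit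
  modulo \<open>d\<close> and \<open>u\<close> is one modulo \<open>n\<close>.\<close>

lemma weight_quandle_isomorphic_equal_gcd:
  assumes n: "n \<ge> 1"
    and d: "d = gcd (int n) (gcd (1 - a) b)" "d = gcd (int n) (gcd (1 - a') b')"
    and g: "gcd (1 - a) (int n) = gcd (1 - a') (int n)"
    and cong: "[d * a = d * a'] (mod int n)"
  shows "quandle_isomorphic (weight_quandle n a b) (weight_quandle n a' b')"
proof -
  have "d > 0" using n by (simp add: d(1))
  have d_dvd: "d dvd int n" "d dvd 1 - a" "d dvd b"
    unfolding d(1) by (meson dvd_trans gcd_dvd1 gcd_dvd2)+
  define h where "h = gcd (1 - a) (int n)"
  have "h \<noteq> 0" using n by (simp add: h_def)
  have "gcd b h = d" "gcd b' h = d"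
    by (simp add: d(1) h_def ac_simps) (unfold d(2) h_def g, simp add: ac_simps)
  then obtain u where u: "coprime u (int n)" "[b * u = b'] (mod h)"
    using associate_mod_unit[of b h b' "int n"] n \<open>h \<noteq> 0\<close> by auto
  have "gcd (1 - a') (int n) = gcd (u * (1 - a)) (int n)"
    using u(1) g by (simp add: gcd_mult_left_left_cancel coprime_commute)
  then obtain w where w: "coprime w (int n)" "[(1 - a') * w = u * (1 - a)] (mod int n)"
    using associate_mod_unit[of "1 - a'" "int n" "u * (1 - a)" "int n"] n by auto
  have "gcd (1 - a') (int n) dvd u * b - b'"
    using u(2) by (simp add: g[symmetric] h_def[symmetric] cong_iff_dvd_diff mult.commute)
  then obtain s where s: "[(1 - a') * s = u * b - b'] (mod int n)"
    by (rule linear_cong_solvable)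
  have cong1: "[(1 - a') * k = (1 - a) * k] (mod int n)" if "d dvd k" for k
  proof (rule mult_cong_of_dvd[OF _ that])
    show "[d * (1 - a') = d * (1 - a)] (mod int n)"
      using cong_diff[OF cong_refl[of d] cong_sym[OF cong]] by (simp add: algebra_simps)
  qed
  define F where "F = (\<lambda>(e :: int, i). w * (i mod d) + e * s + u * (i - i mod d))"
  define f where "f = (\<lambda>y. (fst y, F y mod int n))"
  have F_shift: "[F (shift n k y) = F y + u * k] (mod int n)" if "d dvd k" for k y
  proof -
    obtain e i where y: "y = (e, i)" by (cases y)
    have "(i + k) mod int n mod d = i mod d"
      using that d_dvd(1) by (metis dvd_def mod_mod_cancel mod_mult_self2)
    then have "F (shift n k y) = w * (i mod d) + e * s + u * ((i + k) mod int n - i mod d)"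
      by (simp add: F_def shift_def y)
    also have "[\<dots> = w * (i mod d) + e * s + u * (i + k - i mod d)] (mod int n)"
      by (intro cong_add cong_mult cong_diff cong_refl) simp
    finally show ?thesis
      by (simp add: F_def y algebra_simps)
  qed
  show ?thesis
  proof (rule weight_quandle_isomorphicI[OF n d_dvd(2,3)])
    fix y assume y: "y \<in> {0 :: int, 1} \<times> {0..<int n}"
    then show "f y \<in> {0, 1} \<times> {0..<int n}"
      using n by (auto simp: f_def)
    show "f (shift n k y) = shift n (u * k) (f y)" if "d dvd k" for k
      using F_shift[OF that, of y] by (simp add: f_def shift_def cong_def mod_simps)
    obtain e i where ei: "y = (e, i)" by (cases y)
    have "[weight a' b' (f y) = (1 - a') * F y + e * b'] (mod int n)"
      using weight_pair_mod by (simp add: f_def ei)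
    also have "(1 - a') * F y + e * b' = (1 - a') * w * (i mod d) +
        e * ((1 - a') * s) + u * ((1 - a') * (i - i mod d)) + e * b'"
      by (simp add: F_def ei algebra_simps)
    also have "[\<dots> = u * (1 - a) * (i mod d) + e * (u * b - b') + u * ((1 - a) * (i - i mod d)) + e * b']
        (mod int n)"
      by (intro cong_add cong_mult cong_refl w(2) s cong1) (simp add: minus_mod_eq_mult_div)
    also have "u * (1 - a) * (i mod d) + e * (u * b - b') + u * ((1 - a) * (i - i mod d)) + e * b' =
        u * weight a b y"
      by (simp add: ei weight_def algebra_simps)
    finally show "[weight a' b' (f y) = u * weight a b y] (mod int n)" .
  next
    show "inj_on f ({0, 1} \<times> {0..<int n})"
    proof (rule inj_onI)
      fix x y :: "int \<times> int"
      assume xy: "x \<in> {0, 1} \<times> {0..<int n}" "y \<in> {0, 1} \<times> {0..<int n}" and eq: "f x = f y"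
      obtain e i where x: "x = (e, i)" by (cases x)
      have "fst y = e" using eq by (simp add: f_def x)
      then obtain j where y: "y = (e, j)" by (cases y) simp
      have F: "[F x = F y] (mod int n)"
        using eq by (simp add: f_def cong_def)
      have F_mod: "[F (e, i) = w * i + e * s] (mod d)" for e i
      proof -
        have "[w * (i mod d) + e * s + u * (i - i mod d) = w * i + e * s + u * (i - i)] (mod d)"
          by (intro cong_add cong_mult cong_diff cong_refl) simp_all
        then show ?thesis by (simp add: F_def)
      qed
      have "[w * i + e * s = w * j + e * s] (mod d)"
        using cong_trans[OF cong_sym[OF F_mod[of e i]]
            cong_trans[OF cong_dvd_modulus[OF F d_dvd(1), unfolded x y] F_mod[of e j]]] .
      then have "[w * i = w * j] (mod d)"
        by (simp add: cong_add_rcancel)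
      moreover have "coprime w d"
        using w(1) d_dvd(1) by (meson coprime_divisors dvd_refl)
      ultimately have "i mod d = j mod d"
        by (simp add: cong_mult_lcancel flip: cong_def)
      with F have "[u * (i - j mod d) = u * (j - j mod d)] (mod int n)"
        by (simp add: F_def x y cong_add_lcancel)
      then have "[i - j mod d = j - j mod d] (mod int n)"
        using u(1) by (simp add: cong_mult_lcancel)
      then have "[i = j] (mod int n)"
        using cong_add_rcancel[of i "- (j mod d)" j "int n"] by simp
      then show "x = y"
        using xy by (simp add: x y cong_def)
    qed
  qed
qed


text \<open>Here \<open>n\<close> is an even multiple of \<open>d\<close> and \<open>1 - a\<close> an odd one, so the weight of \<open>(e, i)\<close> in the source
  is an even or odd multiple of \<open>d\<close> according to the parity of \<open>i\<close>. In the target, weights are even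
  multiples of \<open>d\<close> on the coset \<open>e = 0\<close> and odd ones on the coset \<open>e = 1\<close>. So the image of \<open>(e, i)\<close> must lie in the coset of the parity of \<open>i\<close>. The congruence \<open>d a = d a'\<close> forces \<open>d\<close>
  to be even, and the isomorphism is
  \<open>(e, 2 q + r + k) \<mapsto> (r, w q + r s + e t + k)\<close> for \<open>0 \<le> q < d / 2\<close>, \<open>r \<in> {0, 1}\<close> and \<open>d\<close> dividing \<open>k\<close>, with
  \<open>(1 - a') w = 2 (1 - a)\<close> and \<open>(1 - a') s = 1 - a - b'\<close>. The offset \<open>t = (a' - a) / 2\<close> does not affect
  the weight, and it is an odd multiple of \<open>d / 2\<close>, which keeps the images of the two source cosets
  apart: for a given \<open>r\<close>, two images agree modulo \<open>d / 2\<close> only if \<open>q\<close> is the same, and in that case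
  they agree modulo \<open>d\<close> only if \<open>e\<close> is the same, too.\<close>

lemma weight_quandle_isomorphic_double_gcd:
  assumes n: "n \<ge> 1"
    and d: "d = gcd (1 - a) (int n)" "d = gcd (int n) (gcd (1 - a') b')"
    and double: "gcd (1 - a') (int n) = 2 * d"
    and cong: "[d * a = d * a'] (mod int n)"
  shows "quandle_isomorphic (weight_quandle n a 0) (weight_quandle n a' b')"
proof -
  have "d > 0" using n by (simp add: d(1))
  have d_dvd: "d dvd 1 - a" "d dvd int n" "d dvd b'"
    unfolding d(1) by simp_all (metis d dvd_trans gcd_dvd2)
  have d2_dvd: "2 * d dvd 1 - a'" "2 * d dvd int n"
    unfolding double[symmetric] by simp_all
  obtain v v' m \<beta> where v: "1 - a = d * v" and v': "1 - a' = 2 * d * v'"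
    and m: "int n = 2 * d * m" and \<beta>: "b' = d * \<beta>"
    using d_dvd d2_dvd by (meson dvdE)
  have "d * gcd v (2 * m) = gcd (d * v) (d * (2 * m))"
    using \<open>d > 0\<close> gcd_mult_distrib_int[of d v "2 * m"] by simp
  also have "\<dots> = d"
    using d(1) by (simp add: v m ac_simps)
  finally have "gcd v (2 * m) = 1"
    using \<open>d > 0\<close> by simp
  then have cop_v: "coprime v 2" "coprime v m"
    by (simp_all add: coprime_iff_gcd_eq_1[symmetric])
  have "d * gcd (2 * m) (gcd (2 * v') \<beta>) = gcd (d * (2 * m)) (gcd (d * (2 * v')) (d * \<beta>))"
    using \<open>d > 0\<close> gcd_mult_distrib_int[of d "2 * m" "gcd (2 * v') \<beta>"]
      gcd_mult_distrib_int[of d "2 * v'" \<beta>] by simp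
  also have "\<dots> = d"
    using d(2) by (simp add: v' m \<beta> ac_simps)
  finally have "gcd (2 * m) (gcd (2 * v') \<beta>) = 1"
    using \<open>d > 0\<close> by simp
  then have odd_\<beta>: "odd \<beta>"
    by (metis dvd_triv_left gcd_greatest odd_one)
  have odd_v: "odd v"
    using cop_v(1) by simp
  have diff: "a' - a = d * (v - 2 * v')"
    using v v' by (simp add: algebra_simps)
  have "int n dvd d * (a' - a)"
    using cong by (simp add: cong_iff_dvd_diff right_diff_distrib dvd_diff_commute)
  then have n_dvd: "int n dvd d * d * (v - 2 * v')"
    by (simp add: diff mult.assoc)
  then have "d * (2 * m) dvd d * (d * (v - 2 * v'))"
    by (simp add: m ac_simps)
  then have "2 * m dvd d * (v - 2 * v')"
    using \<open>d > 0\<close> by simp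
  then have "even (d * (v - 2 * v'))"
    by (meson dvd_mult_left)
  then have "even d"
    using odd_v by simp
  then obtain c where c: "d = 2 * c" by blast
  have "c > 0" using \<open>d > 0\<close> c by simp
  \<comment> \<open>This is \<open>(a' - a) / 2\<close>, because \<open>a' - a = d * (v - 2 * v')\<close> and \<open>d = 2 * c\<close>.\<close>
  define t where "t = c * (v - 2 * v')"
  have "gcd (1 - a') (int n) = gcd (2 * (1 - a)) (int n)"
  proof -
    have "gcd (2 * (1 - a)) (int n) = gcd (2 * d * v) (2 * d * m)"
      by (simp add: v m mult.assoc)
    also have "\<dots> = 2 * d * gcd v m"
      using \<open>d > 0\<close> gcd_mult_distrib_int[of "2 * d" v m] by simp
    finally show ?thesis
      using cop_v(2) double by simp
  qed
  then obtain w where w: "coprime w (int n)" "[(1 - a') * w = 2 * (1 - a)] (mod int n)"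
    using associate_mod_unit[of "1 - a'" "int n" "2 * (1 - a)" "int n"] n by auto
  have "1 - a - b' = d * (v - \<beta>)"
    by (simp add: v \<beta> algebra_simps)
  moreover have "even (v - \<beta>)"
    using odd_v odd_\<beta> by simp
  ultimately have "gcd (1 - a') (int n) dvd 1 - a - b'"
    unfolding double by (auto simp: mult.commute)
  then obtain s where s: "[(1 - a') * s = 1 - a - b'] (mod int n)"
    by (rule linear_cong_solvable)
  have t: "[(1 - a') * t = 0] (mod int n)"
  proof -
    have "(1 - a') * t = d * d * (v - 2 * v') * v'"
      by (simp add: v' t_def c)
    then show ?thesis
      using n_dvd by (simp add: cong_0_iff)
  qed
  have cong1: "[(1 - a') * k = (1 - a) * k] (mod int n)" if "d dvd k" for k
  proof (rule mult_cong_of_dvd[OF _ that])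
    show "[d * (1 - a') = d * (1 - a)] (mod int n)"
      using cong_diff[OF cong_refl[of d] cong_sym[OF cong]] by (simp add: algebra_simps)
  qed
  define F where "F = (\<lambda>(e :: int, i). w * (i mod d div 2) + (i mod 2) * s + e * t + (i - i mod d))"
  define f where "f = (\<lambda>y. (snd y mod 2, F y mod int n))"
  have mod2: "i mod d mod 2 = i mod 2" for i
    using \<open>even d\<close> by (rule mod_mod_cancel)
  have F_shift: "[F (shift n k y) = F y + k] (mod int n)"
    and shift_mod2: "snd (shift n k y) mod 2 = snd y mod 2" if "d dvd k" for k y
  proof -
    obtain e i where y: "y = (e, i)" by (cases y)
    have d: "(i + k) mod int n mod d = i mod d"
      using that d_dvd(2) by (metis dvd_def mod_mod_cancel mod_mult_self2)
    then have two: "(i + k) mod int n mod 2 = i mod 2"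
      by (metis mod2)
    then show "snd (shift n k y) mod 2 = snd y mod 2"
      by (simp add: shift_def y)
    have "F (shift n k y) =
        w * (i mod d div 2) + (i mod 2) * s + e * t + ((i + k) mod int n - i mod d)"
      by (simp add: F_def shift_def y d two)
    also have "[\<dots> = w * (i mod d div 2) + (i mod 2) * s + e * t + (i + k - i mod d)] (mod int n)"
      by (intro cong_add cong_mult cong_diff cong_refl) simp
    finally show "[F (shift n k y) = F y + k] (mod int n)"
      by (simp add: F_def y algebra_simps)
  qed
  show ?thesis
  proof (rule weight_quandle_isomorphicI[OF n d_dvd(1), where u = 1])
    show "d dvd 0" by simp
    fix y assume y: "y \<in> {0 :: int, 1} \<times> {0..<int n}"
    show "f y \<in> {0, 1} \<times> {0..<int n}"
      using n by (auto simp: f_def)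
    show "f (shift n k y) = shift n (1 * k) (f y)" if "d dvd k" for k
      using F_shift[OF that, of y] shift_mod2[OF that, of y]
      by (simp add: f_def cong_def mod_simps) (simp add: shift_def mod_simps)
    obtain e i where ei: "y = (e, i)" by (cases y)
    define q r where "q = i mod d div 2" and "r = i mod 2"
    have qr: "2 * q + r = i mod d"
      unfolding q_def r_def by (metis mod2 mult_div_mod_eq)
    have "[weight a' b' (f y) = (1 - a') * F y + r * b'] (mod int n)"
      using weight_pair_mod by (simp add: f_def ei r_def)
    also have "(1 - a') * F y + r * b' = (1 - a') * w * q + r * ((1 - a') * s) + e * ((1 - a') * t) +
        (1 - a') * (i - i mod d) + r * b'"
      by (simp add: F_def ei q_def r_def algebra_simps)
    also have "[\<dots> = 2 * (1 - a) * q + r * (1 - a - b') + e * 0 + (1 - a) * (i - i mod d) + r * b']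
        (mod int n)"
      by (intro cong_add cong_mult cong_refl w(2) s t cong1) (simp add: minus_mod_eq_mult_div)
    also have "2 * (1 - a) * q + r * (1 - a - b') + e * 0 + (1 - a) * (i - i mod d) + r * b' =
        1 * weight a 0 y"
      by (simp add: ei weight_def qr[symmetric] algebra_simps)
    finally show "[weight a' b' (f y) = 1 * weight a 0 y] (mod int n)" .
  next
    show "inj_on f ({0, 1} \<times> {0..<int n})"
    proof (rule inj_onI)
      fix x y :: "int \<times> int"
      assume xy: "x \<in> {0, 1} \<times> {0..<int n}" "y \<in> {0, 1} \<times> {0..<int n}" and eq: "f x = f y"
      obtain e i where x: "x = (e, i)" by (cases x)
      obtain e' j where y: "y = (e', j)" by (cases y)
      define q q' where "q = i mod d div 2" and "q' = j mod d div 2"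
      have r: "i mod 2 = j mod 2"
        using eq by (simp add: f_def x y)
      have F: "[F x = F y] (mod int n)"
        using eq by (simp add: f_def cong_def)
      have F_mod: "[F (e, i) = w * (i mod d div 2) + (i mod 2) * s + e * t] (mod d)" for e i
      proof -
        have "[w * (i mod d div 2) + (i mod 2) * s + e * t + (i - i mod d) =
            w * (i mod d div 2) + (i mod 2) * s + e * t + (i - i)] (mod d)"
          by (intro cong_add cong_diff cong_refl) simp_all
        then show ?thesis by (simp add: F_def)
      qed
      have "[w * q + (i mod 2) * s + e * t = w * q' + (i mod 2) * s + e' * t] (mod d)"
        using cong_trans[OF cong_sym[OF F_mod[of e i]]
            cong_trans[OF cong_dvd_modulus[OF F d_dvd(2), unfolded x y] F_mod[of e' j]]]
        by (simp add: q_def q'_def r)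
      then have "[w * q + (i mod 2) * s + e * t - (i mod 2) * s =
          w * q' + (i mod 2) * s + e' * t - (i mod 2) * s] (mod d)"
        by (intro cong_diff cong_refl)
      then have qt: "[w * q + e * t = w * q' + e' * t] (mod d)"
        by (simp add: algebra_simps)
      have "c dvd d" by (simp add: c)
      have et: "[e * t = 0] (mod c)" for e
        by (simp add: t_def cong_0_iff)
      have "[w * q + e * t - e * t = w * q' + e' * t - e' * t] (mod c)"
        by (intro cong_diff cong_dvd_modulus[OF qt \<open>c dvd d\<close>] cong_trans[OF et cong_sym[OF et]])
      then have "[w * q = w * q'] (mod c)" by simp
      moreover have "coprime w c"
        using w(1) d_dvd(2) \<open>c dvd d\<close> by (meson coprime_divisors dvd_refl dvd_trans)
      ultimately have "[q = q'] (mod c)"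
        by (simp add: cong_mult_lcancel)
      moreover have "0 \<le> k mod d div 2" "k mod d div 2 < c" for k
        using pos_mod_bound[OF \<open>d > 0\<close>, of k] pos_mod_sign[OF \<open>d > 0\<close>, of k] by (auto simp: c)
      ultimately have q: "q = q'"
        by (simp add: q_def q'_def cong_def)
      have "[e * t = e' * t] (mod d)"
        using qt by (simp add: q cong_add_lcancel)
      then have "2 * c dvd c * ((e - e') * (v - 2 * v'))"
        by (simp add: cong_iff_dvd_diff c t_def algebra_simps)
      then have "c * 2 dvd c * ((e - e') * (v - 2 * v'))"
        by (simp only: mult.commute)
      then have "even ((e - e') * (v - 2 * v'))"
        using \<open>c > 0\<close> by simp
      then have "even (e - e')"
        using odd_v by simp
      then have e: "e = e'"
        using xy by (auto simp: x y)
      have ij: "i mod d = j mod d"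
      proof -
        have "k mod d = 2 * (k mod d div 2) + k mod 2" for k
          by (metis mod2 mult_div_mod_eq)
        from this[of i] this[of j] show ?thesis
          using q[unfolded q_def q'_def] r by linarith
      qed
      have "[i - j mod d = j - j mod d] (mod int n)"
        using F by (simp add: F_def x y e r ij cong_add_lcancel)
      then have "[i = j] (mod int n)"
        using cong_add_rcancel[of i "- (j mod d)" j "int n"] by simp
      then show "x = y"
        using xy e by (simp add: x y cong_def)
    qed
  qed
qed

theorem corollary1p6:
  fixes n :: nat and a a' b b' d d' :: int
  assumes "n \<ge> 1"
    and "a \<in> cyclic_units n" and "a' \<in> cyclic_units n"
    and "b \<in> carrier (integer_mod_group n)" and "b' \<in> carrier (integer_mod_group n)"
    and "d = Gcd {int n, 1 - a, b}" and "d' = Gcd {int n, 1 - a', b'}"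
  shows "quandle_isomorphic
           (gen_alexander_quandle (dihedral_group n) (dihedral_aut n a b))
           (gen_alexander_quandle (dihedral_group n) (dihedral_aut n a' b')) \<longleftrightarrow>
         card (fixed_points (dihedral_aut n a b) (dihedral_group n)) =
           card (fixed_points (dihedral_aut n a' b') (dihedral_group n)) \<and>
         d = d' \<and>
         [a = a'] (mod (int n div d))"
proof -
  note n = assms(1)
  let ?D = "dihedral_group n"
  let ?Q = "gen_alexander_quandle ?D (dihedral_aut n a b)"
  let ?Q' = "gen_alexander_quandle ?D (dihedral_aut n a' b')"
  let ?W = "weight_quandle n a b" and ?W' = "weight_quandle n a' b'"
  let ?fix = "card (fixed_points (dihedral_aut n a b) ?D)"
  let ?fix' = "card (fixed_points (dihedral_aut n a' b') ?D)"
  have cop: "coprime a (int n)" "coprime a' (int n)"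
    using assms(2,3) by (simp_all add: cyclic_units_def)
  have d: "d = gcd (int n) (gcd (1 - a) b)" and d': "d' = gcd (int n) (gcd (1 - a') b')"
    by (simp_all add: assms(6,7))
  have "d > 0" using n by (simp add: d)
  have sym: "quandle_isomorphic Q (weight_quandle n x y)"
    if "quandle_isomorphic (weight_quandle n x y) Q" for Q :: "(int \<times> int) quandle" and x y
    using quandle_isomorphic_sym[OF that] shift_in_carrier[OF n] by simp
  have carr: "carrier (gen_alexander_quandle ?D \<psi>) = carrier ?D" for \<psi>
    by (simp add: gen_alexander_quandle_def)
  have iso_iff: "quandle_isomorphic ?Q ?Q' \<longleftrightarrow> quandle_isomorphic ?W ?W'"
  proof -
    have QW: "quandle_isomorphic ?Q ?W" "quandle_isomorphic ?Q' ?W'"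
      using n by (rule dihedral_quandle_isomorphic_weight_quandle)+
    have closed: "qsym (gen_alexander_quandle ?D (dihedral_aut n u v)) x y \<in> carrier ?D"
      if "u \<in> cyclic_units n" "x \<in> carrier ?D" "y \<in> carrier ?D" for u v x y
      using that dihedral_aut_iso[OF n that(1)] group_dihedral_group[OF n]
      by (intro qsym_gen_alexander_quandle_closed) (auto simp: iso_def)
    have WQ: "quandle_isomorphic ?W ?Q" "quandle_isomorphic ?W' ?Q'"
      using QW closed assms(2,3) by (auto intro!: quandle_isomorphic_sym simp: carr)
    show ?thesis
      using QW WQ by (meson quandle_isomorphic_trans)
  qed
  have cong_iff: "[a = a'] (mod (int n div d)) \<longleftrightarrow> [d * a = d * a'] (mod int n)"
  proof -
    have "int n = d * (int n div d)" by (simp add: d)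
    then have "int n dvd d * (a - a') \<longleftrightarrow> int n div d dvd a - a'"
      using \<open>d > 0\<close> by (metis dvd_mult_cancel_left less_irrefl)
    then show ?thesis
      by (simp add: cong_iff_dvd_diff right_diff_distrib)
  qed
  show ?thesis
  proof
    assume iso: "quandle_isomorphic ?Q ?Q'"
    then have WW': "quandle_isomorphic ?W ?W'" by (simp add: iso_iff)
    obtain f where f: "f \<in> quandle_iso ?W ?W'"
      using WW' by (auto simp: quandle_isomorphic_def)
    obtain g where g: "g \<in> quandle_iso ?W' ?W"
      using quandle_iso_inverse[OF f] shift_in_carrier[OF n] by simp
    have "d' dvd d"
      unfolding d by (rule weight_quandle_iso_gcd_dvd[OF n cop(1) f])
        (unfold d', (meson dvd_trans gcd_dvd1 gcd_dvd2)+)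
    moreover have "d dvd d'"
      unfolding d' by (rule weight_quandle_iso_gcd_dvd[OF n cop(2) g])
        (unfold d, (meson dvd_trans gcd_dvd1 gcd_dvd2)+)
    ultimately have dd': "d = d'"
      using \<open>d > 0\<close> by (simp add: d' zdvd_antisym_nonneg)
    moreover have "[d * a = d * a'] (mod int n)"
      using weight_quandle_iso_cong[OF n cop f d] d' dd' by simp
    moreover have "?fix = ?fix'"
      using iso dihedral_aut_iso[OF n] assms(2,3)
      by (intro quandle_isomorphic_imp_card_fixed_points_eq group_dihedral_group n)
        (auto simp: iso_def)
    ultimately show "?fix = ?fix' \<and> d = d' \<and> [a = a'] (mod (int n div d))"
      unfolding cong_iff by blast
  next
    assume rhs: "?fix = ?fix' \<and> d = d' \<and> [a = a'] (mod (int n div d))"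
    then have cong: "[d * a = d * a'] (mod int n)" and dd': "d = d'"
      unfolding cong_iff by blast+
    define g g' where "g = gcd (int n) (1 - a)" and "g' = gcd (int n) (1 - a')"
    have "g > 0" "g' > 0" using n by (simp_all add: g_def g'_def)
    have fix_eq: "(if g dvd b then 2 * g else g) = (if g' dvd b' then 2 * g' else g')"
      using rhs card_fixed_points_dihedral_aut[OF n g_def, of b]
        card_fixed_points_dihedral_aut[OF n g'_def, of b'] by simp
    have dg: "d = gcd g b" "d = gcd g' b'"
      by (simp_all add: d g_def gcd.assoc) (simp add: dd' d' g'_def gcd.assoc flip: d)
    have double: "quandle_isomorphic (weight_quandle n x y) (weight_quandle n x' y')"
      if "d = gcd (int n) (1 - x)" "d dvd y" "2 * d = gcd (int n) (1 - x')"
        "d = gcd (int n) (gcd (1 - x') y')" "[d * x = d * x'] (mod int n)" for x y x' y'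
    proof (rule quandle_isomorphic_trans)
      \<comment> \<open>As \<open>y\<close> is a multiple of \<open>1 - x\<close> modulo \<open>n\<close>, it may be replaced by \<open>0\<close>.\<close>
      have "gcd (int n) (gcd (1 - x) y) = d"
        using that(1,2) \<open>d > 0\<close> by (simp add: gcd.assoc[symmetric] gcd_proj1_iff)
      then show "quandle_isomorphic (weight_quandle n x y) (weight_quandle n x 0)"
        using that(1) by (intro weight_quandle_isomorphic_equal_gcd[OF n, of d]) (auto simp: gcd.commute)
      show "quandle_isomorphic (weight_quandle n x 0) (weight_quandle n x' y')"
        using that by (intro weight_quandle_isomorphic_double_gcd[OF n, of d]) (auto simp: gcd.commute)
    qed
    consider "g = g'" | "d = g" "d dvd b" "g' = 2 * d" | "d = g'" "d dvd b'" "g = 2 * d"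
    proof -
      have iff: "g dvd b \<longleftrightarrow> d = g" "g' dvd b' \<longleftrightarrow> d = g'"
        unfolding dg(1) using \<open>g > 0\<close> by (metis gcd_proj1_iff abs_of_pos normalize_int_def)
          (metis dg \<open>g' > 0\<close> gcd_proj1_iff abs_of_pos normalize_int_def)
      show thesis
        by (cases "g dvd b"; cases "g' dvd b'") (use fix_eq iff in \<open>simp_all, (metis that)+\<close>)
    qed
    then have "quandle_isomorphic ?W ?W'"
    proof cases
      case 1
      then show ?thesis
        using d d' dd' cong by (intro weight_quandle_isomorphic_equal_gcd[OF n, of d])
          (simp_all add: g_def g'_def gcd.commute)
    next
      case 2
      then show ?thesis
        using d' dd' cong by (intro double) (simp_all add: g_def g'_def)
    next
      case 3
      then have "quandle_isomorphic ?W' ?W"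
        using d dd' cong by (intro double) (simp_all add: g_def g'_def cong_sym)
      then show ?thesis by (rule sym)
    qed
    then show "quandle_isomorphic ?Q ?Q'" by (simp add: iso_iff)
  qed
qed

end
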